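(* There is a randomized online algorithm for the simple unbounded knapsack problem with competitive ratio in expectation less than $1.7353$.
   Context: Online simple unbounded knapsack problem: knapsack capacity $1$; an instance is a sequence of items $x_1,\dots,x_n$ ($n$ unknown to the algorithm) with sizes $s_i\in[0,1]$ and values $v_i=s_i$. Items arrive one by one; upon arrival of $x_i$ the algorithm irrevocably chooses a number $k_i\in\mathbb{N}_0$ of copies to pack, with the total packed size never exceeding $1$. $\mathrm{opt}(I)=\max\{\sum_i k_i v_i: k_i\in\mathbb{N}_0,\sum_i k_i s_i\le1\}$. For a randomized algorithm, $\mathrm{gain}(I)$ is the expected total packed value, the competitive ratio in expectation on $I$ is $\mathrm{opt}(I)/\mathrm{gain}(I)$, and the competitive ratio in expectation of the algorithm is the supremum of this over all instances. *)

theory Defs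
  imports "HOL-Probability.Probability"
begin

text \<open>
  In the simple problem the value of an item equals its size, so an instance is the list of its
  item sizes, an element of \<open>lists {0..1}\<close>, and one sum serves as both the total packed size and
  the total packed value when \<open>k i\<close> copies of item \<open>i\<close> are packed.
\<close>

definition packed :: "(nat \<Rightarrow> nat) \<Rightarrow> real list \<Rightarrow> real" where
  "packed k I = (\<Sum>i<length I. real (k i) * I ! i)"

definition opt :: "real list \<Rightarrow> real" where
  "opt I = Max {packed k I | k. packed k I \<le> 1}"

text \<open>The maximum is taken over a finite nonempty set, even when items of size 0 are present.\<close>

lemma opt_set_finite:
  assumes "I \<in> lists {0..1}"
  shows "finite {packed k I | k. packed k I \<le> 1}"
proof -
  let ?n = "length I"
  let ?B = "\<lambda>i. {..nat \<lfloor>1 / I ! i\<rfloor>}"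
  have nonneg: "I ! i \<ge> 0" if "i < ?n" for i
    using assms that nth_mem by fastforce
  have "{packed k I | k. packed k I \<le> 1} \<subseteq> (\<lambda>k. packed k I) ` (PiE {..<?n} ?B)"
  proof clarify
    fix k assume le: "packed k I \<le> 1"
    define k' where "k' = restrict (\<lambda>i. if I ! i = 0 then 0 else k i) {..<?n}"
    have "packed k I = packed k' I"
      unfolding packed_def k'_def by (rule sum.cong) auto
    moreover have "k' \<in> PiE {..<?n} ?B"
    proof (rule PiE_I)
      fix i assume i: "i \<in> {..<?n}"
      show "k' i \<in> ?B i"
      proof (cases "I ! i = 0")
        case False
        then have pos: "I ! i > 0" using nonneg i by (simp add: order_less_le)
        have "real (k i) * I ! i \<le> packed k I"
          unfolding packed_def
          by (rule member_le_sum[where f = "\<lambda>i. real (k i) * I ! i"]) (use i nonneg in auto)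
        with le pos have "real (k i) \<le> 1 / I ! i" by (simp add: field_simps)
        then have "k i \<le> nat \<lfloor>1 / I ! i\<rfloor>" by (simp add: le_nat_floor)
        then show ?thesis using i False by (simp add: k'_def)
      qed (use i in \<open>simp add: k'_def\<close>)
    qed (simp add: k'_def)
    ultimately show "packed k I \<in> (\<lambda>k. packed k I) ` (PiE {..<?n} ?B)" by blast
  qed
  moreover have "finite (PiE {..<?n} ?B)" by (intro finite_PiE) auto
  ultimately show ?thesis by (meson finite_imageI finite_subset)
qed

lemma opt_set_nonempty: "0 \<in> {packed k I | k. packed k I \<le> 1}"
  by (auto simp: packed_def intro!: exI[of _ "\<lambda>_. 0"])

text \<open>
  A deterministic online algorithm maps the nonempty list of the items seen so far to the number of
  copies to pack of its last item. It knows neither later items nor their number; its own earlier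
  choices are determined by the list.
\<close>

type_synonym online_rule = "real list \<Rightarrow> nat"

definition copies :: "online_rule \<Rightarrow> real list \<Rightarrow> nat \<Rightarrow> nat" where
  "copies a I = (\<lambda>i. a (take (Suc i) I))"

text \<open>Prefixes of instances are instances, so the bound holds at every intermediate step.\<close>

definition online_algorithm :: "online_rule \<Rightarrow> bool" where
  "online_algorithm a \<longleftrightarrow> (\<forall>I\<in>lists {0..1}. packed (copies a I) I \<le> 1)"

text \<open>
  A randomized algorithm is a deterministic one that additionally reads a random seed drawn once,
  independently of the instance. A real seed with an arbitrary Borel distribution \<open>M\<close> is as general
  as an infinite sequence of random bits.
\<close>

definition randomized_online_algorithm :: "real measure \<Rightarrow> (real \<Rightarrow> online_rule) \<Rightarrow> bool" where
  "randomized_online_algorithm M A \<longleftrightarrow>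
     real_distribution M \<and>
     (\<forall>r. online_algorithm (A r)) \<and>
     (\<forall>I\<in>lists {0..1}. I \<noteq> [] \<longrightarrow> (\<lambda>r. A r I) \<in> M \<rightarrow>\<^sub>M count_space UNIV)"

definition gain :: "real measure \<Rightarrow> (real \<Rightarrow> online_rule) \<Rightarrow> real list \<Rightarrow> real" where
  "gain M A I = (\<integral>r. packed (copies (A r) I) I \<partial>M)"

text \<open>
  In \<^typ>\<open>ennreal\<close>, \<open>x / 0\<close> is \<open>\<infinity>\<close> for \<open>x > 0\<close>, so an instance with positive optimum and gain 0 makes
  the ratio infinite, while \<open>0 / 0 = 0\<close>, so instances with optimum 0 do not affect the supremum.
\<close>

definition competitive_ratio :: "real measure \<Rightarrow> (real \<Rightarrow> online_rule) \<Rightarrow> ennreal" where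
  "competitive_ratio M A = (SUP I\<in>lists {0..1}. ennreal (opt I) / ennreal (gain M A I))"

end

theory Submission
  imports Defs
begin

text \<open>
  The algorithm draws a threshold \<open>t \<ge> 1/2\<close> and packs greedily, ignoring all items whose size lies
  in \<open>(1/2, t)\<close>. As long as only items larger than \<open>1/2\<close> appear, the optimum is the largest of
  them, say \<open>x\<close>, and every threshold \<open>t \<le> x\<close> leads to a load of at least \<open>t\<close>. The best continuous
  distribution has an atom at \<open>1/2\<close> and a density proportional to \<open>1/t\<close> on \<open>[1/2, 1]\<close>, which gives
  the ratio \<open>1 + ln 2\<close>; discretising it to the thresholds \<open>k/14\<close> with \<open>7 \<le> k \<le> 13\<close> costs less
  than \<open>0.04\<close>. Once an item of size \<open>u \<in> (0, 1/2]\<close> appears, greedy packing leaves a gap smaller than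
  \<open>u\<close>; moreover, the load is at least \<open>t\<close> if the knapsack was nonempty before, and at least \<open>2 u\<close>
  otherwise. Averaging these bounds shows that the gain suffices even against the optimum 1.
\<close>

section \<open>The greedy rule with a threshold\<close>

text \<open>For \<open>s = 0\<close> the quotient is 0 by convention, so no copy is packed.\<close>

definition greedy_copies :: "real \<Rightarrow> real \<Rightarrow> real \<Rightarrow> nat" where
  "greedy_copies t b s = (if s \<le> 1/2 \<or> t \<le> s then nat \<lfloor>(1 - b) / s\<rfloor> else 0)"

definition greedy_step :: "real \<Rightarrow> real \<Rightarrow> real \<Rightarrow> real" where
  "greedy_step t b s = b + real (greedy_copies t b s) * s"

definition greedy_load :: "real \<Rightarrow> real list \<Rightarrow> real" where
  "greedy_load t I = foldl (greedy_step t) 0 I"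

text \<open>An \<open>online_rule\<close> sees only the items, so the current load is recomputed
  from the earlier ones.\<close>

definition threshold_rule :: "real \<Rightarrow> online_rule" where
  "threshold_rule t I = greedy_copies t (greedy_load t (butlast I)) (last I)"

lemma greedy_load_Nil [simp]: "greedy_load t [] = 0"
  by (simp add: greedy_load_def)

lemma greedy_load_snoc [simp]:
  "greedy_load t (I @ [s]) = greedy_step t (greedy_load t I) s"
  by (simp add: greedy_load_def)

lemma packed_Nil [simp]: "packed k [] = 0"
  by (simp add: packed_def)

lemma packed_snoc: "packed k (I @ [s]) = packed k I + real (k (length I)) * s"
  by (simp add: packed_def nth_append)

lemma packed_cong: "(\<And>i. i < length I \<Longrightarrow> k i = k' i) \<Longrightarrow> packed k I = packed k' I"
  by (simp add: packed_def)

lemma packed_threshold_rule: "packed (copies (threshold_rule t) I) I = greedy_load t I"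
proof (induction I rule: rev_induct)
  case (snoc s I)
  have "packed (copies (threshold_rule t) (I @ [s])) I = packed (copies (threshold_rule t) I) I"
    by (rule packed_cong) (simp add: copies_def)
  then show ?case
    using snoc by (simp add: packed_snoc greedy_step_def copies_def threshold_rule_def)
qed simp

lemma greedy_step_ge: "0 \<le> s \<Longrightarrow> b \<le> greedy_step t b s"
  by (simp add: greedy_step_def)

lemma greedy_step_le_one:
  assumes "0 \<le> s" "b \<le> 1"
  shows "greedy_step t b s \<le> 1"
proof (cases "s = 0")
  case False
  then have s: "s > 0" using assms by simp
  have "real (nat \<lfloor>(1 - b) / s\<rfloor>) \<le> (1 - b) / s"
    using assms s by simp
  then have "real (nat \<lfloor>(1 - b) / s\<rfloor>) * s \<le> 1 - b"
    using s by (simp add: pos_le_divide_eq)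
  then show ?thesis
    using assms by (simp add: greedy_step_def greedy_copies_def)
qed (use assms in \<open>simp add: greedy_step_def\<close>)

text \<open>If a gap of \<open>s\<close> or more were left, one more copy would fit.\<close>

lemma greedy_step_gap:
  assumes "0 < s" "s \<le> 1/2 \<or> t \<le> s"
  shows "1 - s < greedy_step t b s"
proof -
  have "(1 - b) / s < real (nat \<lfloor>(1 - b) / s\<rfloor>) + 1"
    by linarith
  then have "1 - b < (real (nat \<lfloor>(1 - b) / s\<rfloor>) + 1) * s"
    using assms by (simp add: pos_divide_less_eq)
  then show ?thesis
    using assms by (simp add: greedy_step_def greedy_copies_def algebra_simps)
qed

lemma greedy_step_ge_multiple:
  assumes "0 < s" "s \<le> 1/2 \<or> t \<le> s" "b + real m * s \<le> 1"
  shows "b + real m * s \<le> greedy_step t b s"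
proof -
  have "real m \<le> (1 - b) / s"
    using assms by (simp add: pos_le_divide_eq)
  then have "m \<le> nat \<lfloor>(1 - b) / s\<rfloor>"
    by (simp add: le_nat_floor)
  then show ?thesis
    using assms by (simp add: greedy_step_def greedy_copies_def)
qed

lemma greedy_load_le_one: "I \<in> lists {0..1} \<Longrightarrow> greedy_load t I \<le> 1"
  by (induction I rule: rev_induct) (auto intro: greedy_step_le_one)

lemma greedy_load_append_ge:
  "K \<in> lists {0..1} \<Longrightarrow> greedy_load t J \<le> greedy_load t (J @ K)"
proof (induction K rule: rev_induct)
  case (snoc s K)
  then have "greedy_load t J \<le> greedy_load t (J @ K)" "0 \<le> s" by auto
  then show ?case
    using greedy_load_snoc[of t "J @ K" s] greedy_step_ge order_trans by fastforce
qed simp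

lemma greedy_load_nonneg: "I \<in> lists {0..1} \<Longrightarrow> 0 \<le> greedy_load t I"
  using greedy_load_append_ge[of I t "[]"] by simp

section \<open>Lower bounds on the load\<close>

text \<open>Nothing is added until an item of size at least \<open>t\<close> arrives; that item
  finds the knapsack empty, so one copy fits.\<close>

lemma greedy_load_large_items:
  assumes "I \<in> lists {0..1}" "\<forall>s\<in>set I. s = 0 \<or> 1/2 < s" "0 < t"
  shows "greedy_load t I = 0 \<and> (\<forall>s\<in>set I. s < t) \<or> t \<le> greedy_load t I"
  using assms
proof (induction I rule: rev_induct)
  case (snoc s I)
  then have s: "0 \<le> s" "s \<le> 1" "s = 0 \<or> 1/2 < s"
    and IH: "greedy_load t I = 0 \<and> (\<forall>s\<in>set I. s < t) \<or> t \<le> greedy_load t I"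
    by auto
  show ?case
  proof (cases "t \<le> greedy_load t I")
    case True
    then show ?thesis using greedy_step_ge[OF s(1), of "greedy_load t I" t] by simp
  next
    case False
    with IH have load: "greedy_load t I = 0" "\<forall>s\<in>set I. s < t" by auto
    show ?thesis
    proof (cases "s < t")
      case True
      then have "greedy_step t 0 s = 0"
        using s by (auto simp: greedy_step_def greedy_copies_def)
      then show ?thesis using load True by simp
    next
      case False
      then show ?thesis
        using load greedy_step_ge_multiple[of s t 0 1] s \<open>0 < t\<close> by simp
    qed
  qed
qed simp

text \<open>Here \<open>u\<close> is the first item of size in (0, 1/2], so the load after
  \<open>J\<close> is 0 or at least \<open>t\<close>. From load 0, two copies of \<open>u\<close>
  fit. The items in \<open>K\<close> cannot lower the load.\<close>

lemma greedy_load_small_item: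
  assumes I: "J @ u # K \<in> lists {0..1}" and J: "\<forall>s\<in>set J. s = 0 \<or> 1/2 < s"
    and u: "0 < u" "u \<le> 1/2" and t: "0 < t"
  shows "max (1 - u) (min t (2 * u)) \<le> greedy_load t (J @ u # K)"
proof -
  let ?b = "greedy_load t J"
  have "?b = 0 \<or> t \<le> ?b"
    using greedy_load_large_items[of J t] I J t by auto
  then have "min t (2 * u) \<le> greedy_step t ?b u"
    using greedy_step_ge_multiple[of u t 0 2] greedy_step_ge[of u ?b t] u by auto
  moreover have "1 - u < greedy_step t ?b u"
    using greedy_step_gap u by simp
  moreover have "greedy_step t ?b u \<le> greedy_load t (J @ u # K)"
    using greedy_load_append_ge[of K t "J @ [u]"] I by simp
  ultimately show ?thesis by simp
qed

section \<open>The optimal packing\<close>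

lemma opt_attained:
  assumes "I \<in> lists {0..1}"
  obtains k where "packed k I \<le> 1" "opt I = packed k I"
  using Max_in[OF opt_set_finite[OF assms]] opt_set_nonempty[of I]
  unfolding opt_def by blast

text \<open>Two copies of sizes above 1/2 never fit together, so a feasible packing has at most one
  copy of positive size.\<close>

lemma packed_large_items:
  assumes "\<forall>s\<in>set I. s = 0 \<or> 1/2 < s" "packed k I \<le> 1"
  shows "packed k I = 0 \<or> packed k I \<in> set I \<and> 1/2 < packed k I"
  using assms
proof (induction I rule: rev_induct)
  case (snoc s I)
  let ?n = "k (length I)"
  have s: "s = 0 \<or> 1/2 < s" using snoc.prems by simp
  then have "0 \<le> real ?n * s" by auto
  then have IH: "packed k I = 0 \<or> packed k I \<in> set I \<and> 1/2 < packed k I"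
    using snoc by (auto simp: packed_snoc)
  consider "s = 0 \<or> ?n = 0" | "1/2 < s" "?n = 1" | "1/2 < s" "2 \<le> ?n"
    using s by linarith
  then show ?case
  proof cases
    case 1
    then show ?thesis using IH by (auto simp: packed_snoc)
  next
    case 2
    then show ?thesis using IH snoc.prems by (auto simp: packed_snoc)
  next
    case 3
    then have "2 * s \<le> real ?n * s" by (intro mult_right_mono) auto
    then have "packed k (I @ [s]) > 1"
      using 3 IH unfolding packed_snoc by linarith
    then show ?thesis using snoc.prems by simp
  qed
qed simp

section \<open>Measurability and the law of the threshold\<close>

lemma measurable_greedy_load [measurable]: "(\<lambda>t. greedy_load t I) \<in> borel_measurable borel"
  by (induction I rule: rev_induct) (simp_all add: greedy_step_def greedy_copies_def)

lemma measurable_threshold_rule [measurable]: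
  "(\<lambda>t. threshold_rule t I) \<in> borel \<rightarrow>\<^sub>M count_space UNIV"
  unfolding threshold_rule_def greedy_copies_def by measurable

text \<open>
  The weights solve \<open>w 7 * 7/14 + \<dots> + w k * k/14 = (k + 1)/14\<close>, so that the thresholds up to \<open>x\<close>
  contribute at least \<open>x\<close> before normalisation.
\<close>

definition threshold_weight :: "nat \<Rightarrow> real" where
  "threshold_weight k = (if k = 7 then 8/7 else 1 / real k)"

text \<open>This normalising constant, about 1.7301, is also the bound obtained for the competitive
  ratio.\<close>

definition total_weight :: real where
  "total_weight = sum threshold_weight {7,8,9,10,11,12,13}"

text \<open>The push-forward to the Borel reals is taken because seeds are real numbers.\<close>

definition threshold_distribution :: "real measure" where
  "threshold_distribution =
     distr (point_measure {7,8,9,10,11,12,13} (\<lambda>k. threshold_weight k / total_weight)) borel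
       (\<lambda>k. real k / 14)"

lemma threshold_weight_nonneg: "0 \<le> threshold_weight k"
  by (simp add: threshold_weight_def)

lemma total_weight_pos: "0 < total_weight"
  by (simp add: total_weight_def threshold_weight_def)

lemma total_weight_less: "total_weight < 1.7353"
  by (simp add: total_weight_def threshold_weight_def)

lemma real_distribution_threshold: "real_distribution threshold_distribution"
proof -
  have "prob_space (point_measure {7,8,9,10,11,12,13::nat}
          (\<lambda>k. ennreal (threshold_weight k / total_weight)))"
  proof (rule prob_spaceI)
    have "(\<Sum>k\<in>{7,8,9,10,11,12,13::nat}. threshold_weight k / total_weight) = 1"
      using total_weight_pos unfolding sum_divide_distrib[symmetric] total_weight_def by simp
    moreover have "0 \<le> threshold_weight k / total_weight" for k
      using threshold_weight_nonneg total_weight_pos by (simp add: less_imp_le)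
    ultimately show "emeasure (point_measure {7,8,9,10,11,12,13::nat}
        (\<lambda>k. ennreal (threshold_weight k / total_weight)))
        (space (point_measure {7,8,9,10,11,12,13::nat}
        (\<lambda>k. ennreal (threshold_weight k / total_weight)))) = 1"
      by (subst emeasure_point_measure_finite2)
         (simp_all only: space_point_measure sum_ennreal ennreal_1 finite.intros subset_refl)
  qed
  then have "prob_space threshold_distribution"
    unfolding threshold_distribution_def
    by (rule prob_space.prob_space_distr) simp
  then show ?thesis
    by (simp add: real_distribution_def real_distribution_axioms_def threshold_distribution_def)
qed

section \<open>Gain against optimum\<close>

lemma gain_threshold_rule:
  "total_weight * gain threshold_distribution threshold_rule I =
     (\<Sum>k\<in>{7,8,9,10,11,12,13}. threshold_weight k * greedy_load (real k / 14) I)"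
proof -
  have "gain threshold_distribution threshold_rule I =
      (\<Sum>k\<in>{7,8,9,10,11,12,13}. threshold_weight k / total_weight * greedy_load (real k / 14) I)"
    unfolding gain_def packed_threshold_rule threshold_distribution_def
    by (subst integral_distr)
       (simp_all add: lebesgue_integral_point_measure_finite threshold_weight_nonneg
          total_weight_pos less_imp_le)
  then show ?thesis
    using total_weight_pos by (simp add: field_simps sum_distrib_left)
qed

lemma opt_le_gain:
  assumes I: "I \<in> lists {0..1}"
  shows "opt I \<le> total_weight * gain threshold_distribution threshold_rule I"
proof -
  let ?S = "{7,8,9,10,11,12,13::nat}"
  obtain k where k: "packed k I \<le> 1" "opt I = packed k I"
    using opt_attained[OF I] by blast
  \<comment> \<open>Any bound on the load valid for every threshold can be averaged; both cases
    below use this.\<close>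
  have mono: "(\<Sum>k\<in>?S. threshold_weight k * f (real k / 14)) \<le>
      total_weight * gain threshold_distribution threshold_rule I"
    if f: "\<And>t. 0 < t \<Longrightarrow> f t \<le> greedy_load t I" for f
    unfolding gain_threshold_rule
    by (intro sum_mono mult_left_mono f threshold_weight_nonneg) auto
  show ?thesis
  proof (cases "\<exists>u\<in>set I. 0 < u \<and> u \<le> 1/2")
    case True
    then obtain J u K where split: "I = J @ u # K" "0 < u" "u \<le> 1/2"
      and J: "\<forall>s\<in>set J. \<not> (0 < s \<and> s \<le> 1/2)"
      using split_list_first_prop[of I "\<lambda>u. 0 < u \<and> u \<le> 1/2"] by blast
    have large: "\<forall>s\<in>set J. s = 0 \<or> 1/2 < s"
      using J I split(1) by (force simp: not_less)
    have "max (1 - u) (min t (2 * u)) \<le> greedy_load t I" if "0 < t" for t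
      using greedy_load_small_item[OF I[unfolded split(1)] large split(2,3) that] split(1) by simp
    then have "(\<Sum>k\<in>?S. threshold_weight k * max (1 - u) (min (real k / 14) (2 * u))) \<le>
        total_weight * gain threshold_distribution threshold_rule I"
      by (rule mono)
    \<comment> \<open>The sum is piecewise linear in \<open>u\<close>, so resolving the maxima and
      minima leaves linear inequalities. The bound is tight at \<open>u = 1/2\<close>, where the
      summands are \<open>threshold_weight k * (k / 14)\<close> and add up to 1.\<close>
    moreover have "1 \<le> (\<Sum>k\<in>?S. threshold_weight k * max (1 - u) (min (real k / 14) (2 * u)))"
      using split(2,3)
      by (auto simp: threshold_weight_def max_def min_def diff_divide_distrib)
    ultimately show ?thesis using k by linarith
  next
    case False
    then have large: "\<forall>s\<in>set I. s = 0 \<or> 1/2 < s"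
      using I by fastforce
    show ?thesis
    proof (cases "opt I = 0")
      case True
      then show ?thesis using mono[of "\<lambda>_. 0"] greedy_load_nonneg[OF I] by simp
    next
      case False
      then have opt: "opt I \<in> set I" "1/2 < opt I" "opt I \<le> 1"
        using packed_large_items[OF large k(1)] k by auto
      have "(if t \<le> opt I then t else 0) \<le> greedy_load t I" if "0 < t" for t
        using greedy_load_large_items[OF I large that] opt that greedy_load_nonneg[OF I, of t]
        by auto
      then have "(\<Sum>k\<in>?S. threshold_weight k * (if real k / 14 \<le> opt I then real k / 14 else 0)) \<le>
          total_weight * gain threshold_distribution threshold_rule I"
        by (rule mono)
      moreover have "opt I \<le>
          (\<Sum>k\<in>?S. threshold_weight k * (if real k / 14 \<le> opt I then real k / 14 else 0))"
        using opt by (simp add: threshold_weight_def)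
      ultimately show ?thesis by linarith
    qed
  qed
qed

lemma opt_nonneg: "I \<in> lists {0..1} \<Longrightarrow> 0 \<le> opt I"
  unfolding opt_def by (intro Max_ge opt_set_finite opt_set_nonempty)

theorem theorem4:
  "\<exists>M A. randomized_online_algorithm M A \<and> competitive_ratio M A < ennreal 1.7353"
proof (intro exI conjI)
  show "randomized_online_algorithm threshold_distribution threshold_rule"
    unfolding randomized_online_algorithm_def online_algorithm_def packed_threshold_rule
    using real_distribution_threshold greedy_load_le_one
    by (auto simp: threshold_distribution_def)
  have "ennreal (opt I) / ennreal (gain threshold_distribution threshold_rule I)
      \<le> ennreal total_weight" if I: "I \<in> lists {0..1}" for I
  proof (cases "gain threshold_distribution threshold_rule I > 0")
    case True
    then show ?thesis
      using opt_le_gain[OF I] opt_nonneg[OF I] total_weight_pos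
      by (simp add: divide_ennreal pos_divide_le_eq)
  next
    \<comment> \<open>Division by 0 could give \<infinity> here, so the optimum must be shown to
      vanish as well.\<close>
    case False
    then have "total_weight * gain threshold_distribution threshold_rule I \<le> 0"
      using total_weight_pos by (simp add: mult_le_0_iff)
    then have "opt I = 0"
      using opt_le_gain[OF I] opt_nonneg[OF I] by linarith
    then show ?thesis by simp
  qed
  then have "competitive_ratio threshold_distribution threshold_rule \<le> ennreal total_weight"
    unfolding competitive_ratio_def by (intro SUP_least) auto
  also have "\<dots> < ennreal 1.7353"
    using total_weight_less total_weight_pos by (simp add: ennreal_less_iff)
  finally show "competitive_ratio threshold_distribution threshold_rule < ennreal 1.7353" .
qed

end
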